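(* Let $G$ be an $n$-vertex descendant graph of a rooted tree $T$ with root $r$ and depth $d$. Let the vertices of $G$ be $n$ agents sharing the cake $[0,1]$, each agent $i$ having an integrable non-negative density $v_i$ on $[0,1]$ and valuation $V_i(S)=\int_S v_i(x)\,dx$. Then the algorithm $\mathrm{AlgDescendantGraph}(G)$ (described in the context) outputs an allocation $(A_i)_i$ of the cake that is proportional on $G$, i.e. $V_i(A_i)\ge \frac{1}{|N(i)|}\sum_{j\in N(i)}V_i(A_j)$ for every agent $i$, where $N(i)$ is the set of neighbors of $i$ in $G$, and it uses at most $n^2\cdot d!$ cuts.
   Context: **Cake cutting.** The cake is the interval $[0,1]$. There are $n$ agents; agent $i$ has an integrable non-negative density function $v_i$ on $[0,1]$. A piece is a finite union of disjoint intervals of $[0,1]$, and agent $i$ values a piece $S$ at $V_i(S)=\int_S v_i(x)\,dx$. An allocation is a partition of $[0,1]$ into $n$ disjoint pieces $(A_1,\dots,A_n)$, agent $i$ receiving $A_i$. A cut is a division of the cake at one point; the number of cuts of an algorithm is the total number of cuts made during its execution. **Proportionality on a graph.** For an undirected simple graph $G$ whose vertices are the agents, an allocation is proportional on $G$ if for every $i$, $V_i(A_i)\ge \frac{1}{|N(i)|}\sum_{j\in N(i)}V_i(A_j)$. For a vertex with no neighbors (which occurs here only if $n=1$) the condition is regarded as vacuous. **Descendant graph.** An undirected graph $G=(V,E)$ is a descendant graph on a rooted tree $T$ with root $r$ if $T$ is a spanning tree of $G$ and, for any two vertices $i,j$, $(i,j)\in E$ if and only if one of $i,j$ is a proper ancestor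 of the other in $T$ rooted at $r$. That is, $G$ is obtained from $T$ by connecting all ancestor-descendant pairs. **Notation.** For a vertex $v$ of $T$, $d(v)$ is its depth (the number of edges on the path from $v$ to the root $r$), $d=\max_v d(v)$ is the depth of $T$, $T(v)$ is the subtree rooted at $v$ ($v$ and its descendants), and $|T(v)|$ is its number of vertices. Define $$f(v)=\frac{d(v)+|T(v)|}{d(v)+1}\cdot d!.$$ (This is a positive integer, divisible by $d(v)$ whenever $d(v)\ge 1$.) **Algorithm $\mathrm{AlgDescendantGraph}(G)$.** Initially the root $r$ possesses the whole cake and every other vertex possesses nothing. Process the vertices $u$ of $T$ in increasing order of depth $d(u)$ (ties in any order). When $u$ is processed: 1. (Collect) Let $X^u$ be the union of all cake pieces that $u$ currently possesses. 2. (Cut) Agent $u$ slices $X^u$ into $f(u)$ pieces $X^u_1,\dots,X^u_{f(u)}$ of equal value with respect to $V_u$. 3. (Distribute) For each $v\in T(u)\setminus\{u\}$ in increasing order of $d(v)$ (ties in any order): among the pieces of $X^u_1,\dots,X^u_{f(u)}$ not yet taken, agent $v$ takes $f(v)/d(v)$ pieces that she values the highest (ties broken arbitrarily). The pieces left at the end stay with $u$. The output is the allocation in which each agent gets what she possesses when all vertices have been processed. *)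

theory Defs
  imports "Graph_Theory.Pair_Digraph" "Graph_Theory.Digraph_Component" "HOL-Analysis.Analysis"
begin

section \<open>Pieces, allocations and valuations\<close>

definition piece :: "real set \<Rightarrow> bool" where
  "piece S \<longleftrightarrow> (\<exists>\<I>. finite \<I> \<and> disjoint \<I> \<and> (\<forall>I\<in>\<I>. is_interval I \<and> I \<subseteq> {0..1}) \<and> S = \<Union>\<I>)"

definition allocation :: "'a set \<Rightarrow> ('a \<Rightarrow> real set) \<Rightarrow> bool" where
  "allocation N A \<longleftrightarrow>
     (\<forall>i\<in>N. piece (A i)) \<and> disjoint_family_on A N \<and> (\<Union>i\<in>N. A i) = {0..1}"

definition valuation :: "(real \<Rightarrow> real) \<Rightarrow> real set \<Rightarrow> real" where
  "valuation \<rho> S = set_lebesgue_integral lebesgue S \<rho>"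


section \<open>Descendant graphs\<close>

text \<open>
  Finite simple undirected graphs are the symmetric loop-free digraphs of \<^locale>\<open>pair_graph\<close>.
  The predicate \<open>tree\<close> of the graph library only excludes directed cycles (and counts
  \<open>a, b, a\<close> as a cycle in a symmetric digraph), so it does not describe undirected trees.
\<close>

definition neighbors :: "'a pair_pre_digraph \<Rightarrow> 'a \<Rightarrow> 'a set" where
  "neighbors G i = {j. (i, j) \<in> parcs G}"

definition proportional_on ::
    "'a pair_pre_digraph \<Rightarrow> ('a \<Rightarrow> real \<Rightarrow> real) \<Rightarrow> ('a \<Rightarrow> real set) \<Rightarrow> bool" where
  "proportional_on G \<rho> A \<longleftrightarrow>
     (\<forall>i\<in>pverts G. neighbors G i \<noteq> {} \<longrightarrow>
        valuation (\<rho> i) (A i)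
          \<ge> 1 / real (card (neighbors G i)) * (\<Sum>j\<in>neighbors G i. valuation (\<rho> i) (A j)))"

definition undirected_tree :: "'a pair_pre_digraph \<Rightarrow> bool" where
  "undirected_tree T \<longleftrightarrow> pair_graph T \<and> pverts T \<noteq> {} \<and>
     (\<forall>u\<in>pverts T. \<forall>v\<in>pverts T. \<exists>!p. pre_digraph.apath (with_proj T) u p v)"

definition tree_path :: "'a pair_pre_digraph \<Rightarrow> 'a \<Rightarrow> 'a \<Rightarrow> ('a \<times> 'a) list" where
  "tree_path T u v = (THE p. pre_digraph.apath (with_proj T) u p v)"

definition depth :: "'a pair_pre_digraph \<Rightarrow> 'a \<Rightarrow> 'a \<Rightarrow> nat" where
  "depth T r v = length (tree_path T r v)"

definition tree_depth :: "'a pair_pre_digraph \<Rightarrow> 'a \<Rightarrow> nat" where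
  "tree_depth T r = Max (depth T r ` pverts T)"

definition proper_ancestor :: "'a pair_pre_digraph \<Rightarrow> 'a \<Rightarrow> 'a \<Rightarrow> 'a \<Rightarrow> bool" where
  "proper_ancestor T r u v \<longleftrightarrow> u \<noteq> v \<and>
     u \<in> set (pre_digraph.awalk_verts (with_proj T) r (tree_path T r v))"

definition subtree :: "'a pair_pre_digraph \<Rightarrow> 'a \<Rightarrow> 'a \<Rightarrow> 'a set" where
  "subtree T r v = insert v {w \<in> pverts T. proper_ancestor T r v w}"

definition descendant_graph :: "'a pair_pre_digraph \<Rightarrow> 'a pair_pre_digraph \<Rightarrow> 'a \<Rightarrow> bool" where
  "descendant_graph G T r \<longleftrightarrow>
     pair_graph G \<and> undirected_tree T \<and> spanning (with_proj T) (with_proj G) \<and> r \<in> pverts T \<and>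
     (\<forall>i\<in>pverts G. \<forall>j\<in>pverts G.
        (i, j) \<in> parcs G \<longleftrightarrow> proper_ancestor T r i j \<or> proper_ancestor T r j i)"


section \<open>The algorithm\<close>

definition num_slices :: "'a pair_pre_digraph \<Rightarrow> 'a \<Rightarrow> 'a \<Rightarrow> real" where
  "num_slices T r v =
     real (depth T r v + card (subtree T r v)) / real (depth T r v + 1) * fact (tree_depth T r)"

text \<open>
  \<open>X\<close> is divided at the points of \<open>C\<close> and the resulting parts, the components of \<open>X - C\<close>, are
  grouped into \<open>m\<close> pieces; a cut point itself may go to any piece. Dividing into \<open>m\<close> pieces
  takes at most \<open>m - 1\<close> cuts, as when the \<open>m\<close> pieces are marked off from left to right.
\<close>

definition slicing :: "real set \<Rightarrow> real set \<Rightarrow> nat \<Rightarrow> (nat \<Rightarrow> real set) \<Rightarrow> bool" where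
  "slicing X C m Y \<longleftrightarrow>
     finite C \<and> C \<subseteq> X \<and> card C < m \<and>
     (\<forall>k<m. piece (Y k)) \<and> disjoint_family_on Y {..<m} \<and> (\<Union>k<m. Y k) = X \<and>
     (\<forall>K\<in>components (X - C). \<exists>k<m. K \<subseteq> Y k)"

text \<open>
  In \<open>Ready D H c\<close> the vertices in \<open>D\<close> have been processed, agent \<open>i\<close> possesses \<open>H i\<close> and \<open>c\<close>
  cuts have been made. In \<open>Distributing D H c u Y U W\<close> agent \<open>u\<close> has sliced her cake into the
  pieces \<open>Y k\<close>; the indices of the pieces not yet taken form \<open>U\<close>, and the agents in \<open>W\<close> are
  still to choose. Slices are referred to by index since several of them may be empty.
\<close>

datatype 'a state =
    Ready "'a set" "'a \<Rightarrow> real set" nat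
  | Distributing "'a set" "'a \<Rightarrow> real set" nat 'a "nat \<Rightarrow> real set" "nat set" "'a set"

definition initial_state :: "'a \<Rightarrow> 'a state" where
  "initial_state r = Ready {} (\<lambda>i. if i = r then {0..1} else {}) 0"

text \<open>
  All choices left open by the algorithm (order among vertices of equal depth, position of the
  cuts, ties among equally valued slices) are nondeterministic. Slice counts are compared as
  reals, so that a step is possible only if the prescribed count is an integer.
\<close>

inductive step :: "'a pair_pre_digraph \<Rightarrow> 'a \<Rightarrow> ('a \<Rightarrow> real \<Rightarrow> real) \<Rightarrow> 'a state \<Rightarrow> 'a state \<Rightarrow> bool"
  for T :: "'a pair_pre_digraph" and r :: 'a and \<rho> :: "'a \<Rightarrow> real \<Rightarrow> real" where
  cut:
    "step T r \<rho> (Ready D H c) (Distributing D H (c + card C) u Y {..<m} (subtree T r u - {u}))"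
    if "u \<in> pverts T - D"
      and "\<forall>w\<in>pverts T - D. depth T r u \<le> depth T r w"
      and "real m = num_slices T r u"
      and "slicing (H u) C m Y"
      and "\<forall>k<m. \<forall>l<m. valuation (\<rho> u) (Y k) = valuation (\<rho> u) (Y l)"
| take:
    "step T r \<rho> (Distributing D H c u Y U W)
       (Distributing D (H(v := H v \<union> (\<Union>k\<in>K. Y k))) c u Y (U - K) (W - {v}))"
    if "v \<in> W"
      and "\<forall>w\<in>W. depth T r v \<le> depth T r w"
      and "K \<subseteq> U"
      and "real (card K) = num_slices T r v / real (depth T r v)"
      and "\<forall>k\<in>K. \<forall>l\<in>U - K. valuation (\<rho> v) (Y l) \<le> valuation (\<rho> v) (Y k)"
| finish:
    "step T r \<rho> (Distributing D H c u Y U {}) (Ready (insert u D) (H(u := (\<Union>k\<in>U. Y k))) c)"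

end

theory Submission
  imports Defs "HOL-Library.Sublist"
begin

text \<open>
  The slice counts telescope so that every agent ends up keeping exactly \<open>d!\<close> of her own slices.
  When an agent \<open>i\<close> picks \<open>f(i)/d(i)\<close> slices from the cake of an ancestor \<open>u\<close>, the slices that go to
  her proper descendants later and those that remain with \<open>u\<close> number \<open>f(i)\<close> in total, and none of
  them is worth more to \<open>i\<close> than the average slice she picked. So what \<open>T(i)\<close> and \<open>u\<close> hold of \<open>u\<close>'s
  cake is worth at most \<open>d(i) + 1\<close> times her pick. Summing over all ancestors, \<open>T(i)\<close> and the
  ancestors of \<open>i\<close> together hold at most \<open>(d(i) + 1) V\<^sub>i(X\<^sup>i) = (d(i) + |T(i)|) V\<^sub>i(A\<^sub>i)\<close>,
  which is proportionality. The cuts number at most \<open>\<Sum>v. f(v)\<close>, and \<open>f(v) \<le> n d!\<close>.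
\<close>

section \<open>Descendant relation of a rooted tree\<close>

lemma sum_inverse_telescope:
  "a \<le> b \<Longrightarrow> (\<Sum>k\<in>{a<..b}. 1 / (real k * (real k + 1))) = 1 / (real a + 1) - 1 / (real b + 1)"
proof (induction b rule: dec_induct)
  case (step b)
  have "{a<..Suc b} = insert (Suc b) {a<..b}" using step.hyps by auto
  moreover have "1 / (real (Suc b) * (real (Suc b) + 1)) = 1 / (real b + 1) - 1 / (real (Suc b) + 1)"
    by (simp add: field_simps)
  ultimately show ?case using step.IH by simp
qed simp

locale rooted_tree =
  fixes T :: "'a pair_pre_digraph" and r :: 'a
  assumes tree: "undirected_tree T" and root_in_verts: "r \<in> pverts T"
begin

abbreviation "V \<equiv> pverts T"
abbreviation "dep \<equiv> depth T r"
abbreviation "anc \<equiv> proper_ancestor T r"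
abbreviation "sub \<equiv> subtree T r"
abbreviation "slices \<equiv> num_slices T r"
abbreviation "maxdep \<equiv> tree_depth T r"

sublocale pair_graph T
  using tree by (simp add: undirected_tree_def)

definition branch :: "'a \<Rightarrow> 'a list" where
  "branch v = pawalk_verts r (tree_path T r v)"

definition ancestors :: "'a \<Rightarrow> 'a set" where
  "ancestors v = {u. anc u v}"

lemma unique_apath: "v \<in> V \<Longrightarrow> \<exists>!p. apath r p v"
  using tree root_in_verts by (auto simp: undirected_tree_def)

lemma apath_tree_path: "v \<in> V \<Longrightarrow> apath r (tree_path T r v) v"
  unfolding tree_path_def by (rule theI'[OF unique_apath])

lemma tree_path_eqI: "v \<in> V \<Longrightarrow> apath r p v \<Longrightarrow> tree_path T r v = p"
  unfolding tree_path_def by (rule the1_equality[OF unique_apath])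

lemma distinct_branch: "v \<in> V \<Longrightarrow> distinct (branch v)"
  using apath_tree_path[of v] by (auto simp: branch_def apath_def)

lemma set_branch: "v \<in> V \<Longrightarrow> set (branch v) \<subseteq> V"
  using apath_tree_path[of v] by (auto simp: branch_def apath_def)

lemma last_branch: "v \<in> V \<Longrightarrow> last (branch v) = v"
  using apath_tree_path[of v] by (auto simp: branch_def apath_def)

lemma hd_branch: "v \<in> V \<Longrightarrow> hd (branch v) = r"
  using apath_tree_path[of v] by (auto simp: branch_def apath_def)

lemma length_branch: "length (branch v) = Suc (dep v)"
  by (simp add: branch_def depth_def length_awalk_verts)

lemma branch_nonempty: "branch v \<noteq> []"
  using length_branch[of v] by auto

lemma self_in_branch: "v \<in> V \<Longrightarrow> v \<in> set (branch v)"
  using last_in_set[OF branch_nonempty] last_branch by metis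

lemma anc_iff_branch: "anc u v \<longleftrightarrow> u \<noteq> v \<and> u \<in> set (branch v)"
  by (simp add: proper_ancestor_def branch_def)

text \<open>Cutting the root path of \<open>v\<close> at \<open>u\<close> leaves a simple path from
  \<open>r\<close> to \<open>u\<close>; by uniqueness it is the root path of
  \<open>u\<close>.\<close>

lemma prefix_branch:
  assumes "v \<in> V" "u \<in> set (branch v)"
  shows "prefix (branch u) (branch v)"
proof -
  obtain xs ys where xy: "branch v = xs @ u # ys"
    using assms(2) by (auto simp: in_set_conv_decomp)
  have ap: "apath r (tree_path T r v) v" by (rule apath_tree_path[OF assms(1)])
  then have "pcas r (tree_path T r v) v" by (auto simp: apath_def)
  then obtain q q' where q: "pcas r q u" "tree_path T r v = q @ q'"
      "pawalk_verts r q = xs @ [u]"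
    using awalk_decomp_verts[OF _ xy[unfolded branch_def]] by metis
  have "apath r q u"
    using ap q by (auto simp: apath_append_iff)
  then have "branch u = xs @ [u]"
    using tree_path_eqI[of u q] q(3) assms set_branch[of v] by (auto simp: branch_def)
  then show ?thesis using xy by auto
qed

text \<open>Ancestry becomes the strict prefix order on lists, which supplies transitivity and,
  through lengths, the strict growth of depth.\<close>

lemma anc_iff_strict_prefix:
  assumes "u \<in> V" "v \<in> V"
  shows "anc u v \<longleftrightarrow> strict_prefix (branch u) (branch v)"
proof
  assume "anc u v"
  then have "prefix (branch u) (branch v)" "u \<noteq> v"
    using prefix_branch assms by (auto simp: anc_iff_branch)
  then show "strict_prefix (branch u) (branch v)"
    using last_branch assms by (metis prefix_order.le_less)
next
  assume "strict_prefix (branch u) (branch v)"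
  then show "anc u v"
    using self_in_branch[OF assms(1)] by (auto simp: anc_iff_branch strict_prefix_def dest: set_mono_prefix)
qed

lemma anc_in_verts: "anc u v \<Longrightarrow> v \<in> V \<Longrightarrow> u \<in> V"
  using set_branch by (auto simp: anc_iff_branch)

lemma anc_depth: "anc u v \<Longrightarrow> v \<in> V \<Longrightarrow> dep u < dep v"
  using anc_iff_strict_prefix[of u v] anc_in_verts[of u v]
    prefix_length_less[of "branch u" "branch v"] by (simp add: length_branch)

lemma anc_irrefl: "\<not> anc v v"
  by (simp add: anc_iff_branch)

lemma anc_trans: "anc u v \<Longrightarrow> anc v w \<Longrightarrow> w \<in> V \<Longrightarrow> anc u w"
  by (meson anc_iff_strict_prefix anc_in_verts prefix_order.less_trans)

text \<open>Two prefixes of the same list are comparable.\<close>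

lemma anc_linear:
  assumes "anc u w" "anc v w" "w \<in> V"
  shows "u = v \<or> anc u v \<or> anc v u"
proof -
  have uv: "u \<in> V" "v \<in> V" using assms anc_in_verts by blast+
  have "prefix (branch u) (branch w)" "prefix (branch v) (branch w)"
    using assms by (auto simp: anc_iff_branch intro: prefix_branch)
  then have "u \<in> set (branch v) \<or> v \<in> set (branch u)"
    using prefix_same_cases uv self_in_branch set_mono_prefix by blast
  then show ?thesis by (auto simp: anc_iff_branch)
qed

lemma finite_ancestors: "finite (ancestors v)"
  by (rule finite_subset[of _ "set (branch v)"]) (auto simp: ancestors_def anc_iff_branch)

lemma card_ancestors: "v \<in> V \<Longrightarrow> card (ancestors v) = dep v"
proof -
  assume v: "v \<in> V"
  have "ancestors v = set (branch v) - {v}" by (auto simp: ancestors_def anc_iff_branch)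
  then show ?thesis
    using self_in_branch[OF v] distinct_card[OF distinct_branch[OF v]] length_branch[of v]
    by simp
qed

lemma branch_root: "branch r = [r]"
proof -
  have "tree_path T r r = []"
    by (rule tree_path_eqI) (auto simp: root_in_verts apath_Nil_iff)
  then show ?thesis by (simp add: branch_def)
qed

lemma ancestors_root: "ancestors r = {}"
  by (auto simp: ancestors_def anc_iff_branch branch_root)

lemma depth_root: "dep r = 0"
  using length_branch[of r] by (simp add: branch_root)

lemma anc_root: "v \<in> V \<Longrightarrow> v \<noteq> r \<Longrightarrow> anc r v"
  using hd_branch[of v] hd_in_set[OF branch_nonempty[of v]] by (simp add: anc_iff_branch)

lemma mem_sub_iff: "w \<in> sub v \<longleftrightarrow> w = v \<or> w \<in> V \<and> anc v w"
  by (auto simp: subtree_def)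

lemma sub_subset: "v \<in> V \<Longrightarrow> sub v \<subseteq> V"
  by (auto simp: mem_sub_iff)

lemma finite_sub: "v \<in> V \<Longrightarrow> finite (sub v)"
  using sub_subset pair_finite_verts finite_subset by blast

lemma sub_root: "sub r = V"
  using anc_root root_in_verts unfolding set_eq_iff mem_sub_iff by blast

lemma sub_mono: "v \<in> V \<Longrightarrow> v \<in> sub u \<Longrightarrow> sub v \<subseteq> sub u"
  by (auto simp: mem_sub_iff intro: anc_trans)

lemma sub_proper_descendant:
  assumes "u \<in> V" "w \<in> sub u - {u}"
  shows "sub w \<subseteq> sub u - {u}"
proof -
  have w: "w \<in> V" "anc u w" using assms by (auto simp: mem_sub_iff)
  then have "u \<notin> sub w"
    using anc_depth[of u w] anc_depth[of w u] assms(1) by (auto simp: mem_sub_iff)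
  then show ?thesis using sub_mono[of w u] assms w by auto
qed

lemma ancestors_disjoint_sub: "v \<in> V \<Longrightarrow> ancestors v \<inter> sub v = {}"
  using anc_irrefl anc_trans[of v _ v] by (auto simp: ancestors_def mem_sub_iff)

lemma card_sub_pos: "v \<in> V \<Longrightarrow> card (sub v) > 0"
  using finite_sub[of v] by (auto simp: card_gt_0_iff mem_sub_iff)

lemma depth_plus_card_sub: "v \<in> V \<Longrightarrow> dep v + card (sub v) \<le> card V"
proof -
  assume v: "v \<in> V"
  have "dep v + card (sub v) = card (ancestors v \<union> sub v)"
    using v finite_ancestors[of v] finite_sub[OF v] ancestors_disjoint_sub[OF v]
    by (simp add: card_Un_disjoint card_ancestors)
  also have "\<dots> \<le> card V"
    using v sub_subset[OF v] anc_in_verts[of _ v]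
    by (intro card_mono pair_finite_verts) (auto simp: ancestors_def)
  finally show ?thesis .
qed

text \<open>The ancestors form a chain along which depth strictly increases, so their depths differ;
  being \<open>dep v\<close> numbers below \<open>dep v\<close>, they exhaust the range.\<close>

lemma bij_betw_depth_ancestors:
  assumes "v \<in> V"
  shows "bij_betw dep (ancestors v) {..<dep v}"
proof -
  have "inj_on dep (ancestors v)"
    using assms anc_linear[of _ v] anc_in_verts[of _ v] anc_depth
    by (intro inj_onI) (fastforce simp: ancestors_def)
  moreover from this have "dep ` ancestors v = {..<dep v}"
    using assms anc_depth[of _ v] card_ancestors[OF assms]
    by (intro card_subset_eq finite_lessThan) (auto simp: ancestors_def card_image)
  ultimately show ?thesis by (rule bij_betw_imageI)
qed

text \<open>Allows \<open>sum_share\<close> to turn a sum along the path from \<open>u\<close> down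
  to \<open>w\<close>, without \<open>u\<close>, into a sum over consecutive depths.\<close>

lemma bij_betw_depth_between:
  assumes "w \<in> V" "anc u w"
  shows "bij_betw dep {v. anc u v \<and> w \<in> sub v} {dep u<..dep w}"
proof -
  \<comment> \<open>Every ancestor of \<open>w\<close> is comparable with \<open>u\<close>, so for
    these vertices lying below \<open>u\<close> amounts to having larger depth.\<close>
  have eq: "{v. anc u v \<and> w \<in> sub v} = insert w {v \<in> ancestors w. dep u < dep v}" 
  proof (intro equalityI subsetI)
    fix v assume "v \<in> {v. anc u v \<and> w \<in> sub v}"
    then show "v \<in> insert w {v \<in> ancestors w. dep u < dep v}"
      using assms(1) anc_depth[of u v] anc_in_verts[of v w] by (auto simp: mem_sub_iff ancestors_def)
  next
    fix v assume "v \<in> insert w {v \<in> ancestors w. dep u < dep v}"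
    then consider "v = w" | "anc v w" "dep u < dep v" by (auto simp: ancestors_def)
    then show "v \<in> {v. anc u v \<and> w \<in> sub v}"
    proof cases
      case 2
      then have "anc u v"
        using anc_linear[OF assms(2) 2(1) assms(1)] anc_depth[of v u] anc_in_verts[OF assms(2,1)]
        by auto
      then show ?thesis using 2 assms by (simp add: mem_sub_iff)
    qed (use assms in \<open>simp add: mem_sub_iff\<close>)
  qed
  have "bij_betw dep {v \<in> ancestors w. dep u < dep v} {dep u<..<dep w}"
  proof (rule bij_betw_subset[OF bij_betw_depth_ancestors[OF assms(1)]])
    show "dep ` {v \<in> ancestors w. dep u < dep v} = {dep u<..<dep w}"
    proof (intro equalityI subsetI)
      fix k assume k: "k \<in> {dep u<..<dep w}"
      then have "k \<in> dep ` ancestors w"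
        using bij_betw_imp_surj_on[OF bij_betw_depth_ancestors[OF assms(1)]] by simp
      then show "k \<in> dep ` {v \<in> ancestors w. dep u < dep v}" using k by auto
    qed (use anc_depth[of _ w] assms(1) in \<open>auto simp: ancestors_def\<close>)
  qed auto
  then have "bij_betw dep ({v \<in> ancestors w. dep u < dep v} \<union> {w}) ({dep u<..<dep w} \<union> {dep w})"
    by (rule bij_betw_combine) auto
  moreover have "{dep u<..<dep w} \<union> {dep w} = {dep u<..dep w}"
    using anc_depth[OF assms(2,1)] by auto
  ultimately show ?thesis by (simp add: eq)
qed

section \<open>Integrality and telescoping of the slice counts\<close>

lemma depth_le_maxdep: "v \<in> V \<Longrightarrow> dep v \<le> maxdep"
  by (simp add: tree_depth_def pair_finite_verts)

lemma sub_leaf: "v \<in> V \<Longrightarrow> dep v = maxdep \<Longrightarrow> sub v = {v}"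
  using anc_depth[of v] depth_le_maxdep by (fastforce simp: mem_sub_iff)

lemma depth_pos: "v \<in> V \<Longrightarrow> anc u v \<Longrightarrow> 0 < dep v"
  using anc_depth by fastforce

lemma slices_pos: "v \<in> V \<Longrightarrow> slices v > 0"
  using card_sub_pos[of v] by (simp add: num_slices_def divide_pos_pos add_pos_nonneg add_nonneg_pos)

definition share :: "'a \<Rightarrow> real" where
  "share v = slices v / real (dep v)"

lemma share_pos: "v \<in> V \<Longrightarrow> dep v > 0 \<Longrightarrow> share v > 0"
  using slices_pos by (simp add: share_def)

text \<open>Above the deepest level \<open>dep v + 1\<close> divides \<open>fact maxdep\<close>. On
  the deepest level this may fail, but there \<open>v\<close> is a leaf and the fraction in front of
  the factorial is 1.\<close>

lemma slices_nat:
  assumes "v \<in> V"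
  obtains m :: nat where "real m = slices v"
proof (cases "dep v = maxdep")
  case True
  then show ?thesis
    using assms sub_leaf[OF assms True]
    by (intro that[of "fact maxdep"]) (simp add: num_slices_def)
next
  case False
  then have "dep v + 1 \<le> maxdep" using depth_le_maxdep[OF assms] by simp
  then have "dep v + 1 dvd fact maxdep"
    by (intro dvd_fact) auto
  then obtain k where "fact maxdep = (dep v + 1) * k" by (auto simp: dvd_def)
  then have "(fact maxdep :: real) = (real (dep v) + 1) * real k"
    by (metis of_nat_1 of_nat_add of_nat_fact of_nat_mult)
  then show ?thesis
    by (intro that[of "(dep v + card (sub v)) * k"])
      (simp add: num_slices_def eq_divide_eq add_eq_0_iff add_nonneg_eq_0_iff algebra_simps)
qed

text \<open>Besides \<open>dep v + 1\<close>, the factor \<open>dep v\<close> has to be divided out.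
  Both occur in \<open>fact (Suc (dep v))\<close>, which divides \<open>fact maxdep\<close> unless
  \<open>v\<close> has maximal depth; in that case the share is
  \<open>fact (dep v - 1)\<close>.\<close>

lemma share_nat:
  assumes "v \<in> V" "dep v > 0"
  obtains p :: nat where "real p = share v" 
proof (cases "dep v = maxdep")
  case True
  then have "(fact maxdep :: real) = dep v * fact (dep v - 1)"
    using assms by (simp add: fact_reduce)
  then show ?thesis
    using assms sub_leaf[OF assms(1) True]
    by (intro that[of "fact (dep v - 1)"]) (simp add: share_def num_slices_def)
next
  case False
  then have "Suc (dep v) \<le> maxdep" using depth_le_maxdep[OF assms(1)] by simp
  then have "fact (Suc (dep v)) dvd (fact maxdep :: nat)"
    by (rule fact_dvd)
  then obtain k where "fact maxdep = (fact (Suc (dep v)) :: nat) * k" by (auto simp: dvd_def)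
  then have "(fact maxdep :: real) = fact (Suc (dep v)) * real k"
    by (metis of_nat_fact of_nat_mult)
  also have "\<dots> = (real (dep v) + 1) * real (dep v) * (fact (dep v - 1) * real k)"
    using assms(2) fact_reduce[of "dep v", where 'a=real] by (simp add: algebra_simps)
  finally have "share v = real (dep v + card (sub v)) * (fact (dep v - 1) * real k)"
    using assms(2) by (simp add: share_def num_slices_def divide_eq_eq add_nonneg_eq_0_iff)
  then show ?thesis
    by (intro that[of "(dep v + card (sub v)) * (fact (dep v - 1) * k)"]) simp
qed

text \<open>A share is \<open>fact maxdep\<close> times
  \<open>card (sub v) / (dep v * (dep v + 1)) + 1 / (dep v + 1)\<close>. Counting the members
  \<open>w\<close> of each \<open>sub v\<close> and exchanging the sums leaves, for each
  \<open>w\<close>, a telescoping sum along the path from \<open>u\<close> to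
  \<open>w\<close>.\<close>

lemma sum_share:
  assumes u: "u \<in> V"
  shows "(\<Sum>v\<in>sub u - {u}. share v) = slices u - fact maxdep"
proof -
  let ?S = "sub u - {u}" and ?g = "\<lambda>v. 1 / (real (dep v) * (real (dep v) + 1))"
  have S: "v \<in> ?S \<longleftrightarrow> v \<in> V \<and> anc u v" for v
    using anc_irrefl by (auto simp: mem_sub_iff)
  have fin: "finite ?S" using finite_sub[OF u] by simp
  have "(\<Sum>v\<in>?S. real (card (sub v)) * ?g v) = (\<Sum>v\<in>?S. \<Sum>w\<in>{w \<in> ?S. w \<in> sub v}. ?g v)"
  proof (rule sum.cong[OF refl])
    fix v assume "v \<in> ?S"
    then have v: "v \<in> V" "anc u v" using S by blast+
    then have "sub v \<subseteq> ?S"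
      using anc_trans[of u v] unfolding subset_iff S mem_sub_iff by blast
    then have "{w \<in> ?S. w \<in> sub v} = sub v" by blast
    then show "real (card (sub v)) * ?g v = (\<Sum>w\<in>{w \<in> ?S. w \<in> sub v}. ?g v)" by simp
  qed
  also have "\<dots> = (\<Sum>w\<in>?S. \<Sum>v\<in>{v \<in> ?S. w \<in> sub v}. ?g v)"
    by (rule sum.swap_restrict[OF fin fin])
  also have "\<dots> = (\<Sum>w\<in>?S. 1 / (real (dep u) + 1) - 1 / (real (dep w) + 1))"
  proof (rule sum.cong[OF refl])
    fix w assume w: "w \<in> ?S"
    then have uw: "w \<in> V" "anc u w" using S by blast+
    have "{v \<in> ?S. w \<in> sub v} = {v. anc u v \<and> w \<in> sub v}"
      using S uw anc_in_verts[of _ w] by (auto simp: mem_sub_iff)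
    then have "(\<Sum>v\<in>{v \<in> ?S. w \<in> sub v}. ?g v) = (\<Sum>k\<in>{dep u<..dep w}. 1 / (real k * (real k + 1)))"
      using sum.reindex_bij_betw[OF bij_betw_depth_between[OF uw], of "\<lambda>k. 1 / (real k * (real k + 1))"]
      by simp
    also have "\<dots> = 1 / (real (dep u) + 1) - 1 / (real (dep w) + 1)"
      using anc_depth[OF uw(2,1)] by (intro sum_inverse_telescope) simp
    finally show "(\<Sum>v\<in>{v \<in> ?S. w \<in> sub v}. ?g v) = 1 / (real (dep u) + 1) - 1 / (real (dep w) + 1)" .
  qed
  \<comment> \<open>The added terms \<open>1 / (dep v + 1)\<close> cancel the lower ends of the
    telescoping sums, so every proper descendant of \<open>u\<close> contributes just
    \<open>1 / (dep u + 1)\<close>.\<close>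
  finally have tele: "(\<Sum>v\<in>?S. real (card (sub v)) * ?g v + 1 / (real (dep v) + 1))
      = real (card ?S) / (real (dep u) + 1)"
    by (simp add: sum.distrib sum_subtractf)
  have "(\<Sum>v\<in>?S. share v) = fact maxdep * (\<Sum>v\<in>?S. real (card (sub v)) * ?g v + 1 / (real (dep v) + 1))"
    unfolding sum_distrib_left
  proof (rule sum.cong[OF refl])
    fix v assume "v \<in> ?S"
    then have "dep v > 0" using S depth_pos by blast
    then show "share v = fact maxdep * (real (card (sub v)) * ?g v + 1 / (real (dep v) + 1))"
      by (simp add: share_def num_slices_def divide_simps) (simp add: algebra_simps)
  qed
  moreover have "real (card ?S) = real (card (sub u)) - 1"
    using card_sub_pos[OF u] by (simp add: card_Diff_singleton mem_sub_iff of_nat_diff)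
  ultimately show ?thesis
    unfolding tele by (simp add: num_slices_def divide_simps) (simp add: algebra_simps)
qed

end

section \<open>Pieces and slicings into parts of equal value\<close>

lemma piece_empty [simp]: "piece {}"
  unfolding piece_def by (intro exI[of _ "{}"]) (simp add: disjoint_def)

lemma piece_unit_interval: "piece {0..1}"
  unfolding piece_def by (intro exI[of _ "{{0..1}}"]) (simp add: disjoint_def is_interval_cc)

lemma piece_subset: "piece S \<Longrightarrow> S \<subseteq> {0..1}"
  by (auto simp: piece_def)

lemma piece_Int_interval:
  assumes "piece S" "is_interval J"
  shows "piece (S \<inter> J)"
proof -
  obtain \<I> where I: "finite \<I>" "disjoint \<I>" "\<forall>I\<in>\<I>. is_interval I \<and> I \<subseteq> {0..1}" "S = \<Union>\<I>"
    using assms(1) by (auto simp: piece_def)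
  have "disjoint ((\<lambda>I. I \<inter> J) ` \<I>)"
    using I(2) unfolding disjoint_def by blast
  moreover have "\<forall>I\<in>(\<lambda>I. I \<inter> J) ` \<I>. is_interval I \<and> I \<subseteq> {0..1}"
    using I(3) assms(2) by (auto intro: is_interval_Int)
  ultimately show ?thesis
    unfolding piece_def using I(1,4) by (intro exI[of _ "(\<lambda>I. I \<inter> J) ` \<I>"]) auto
qed

lemma piece_Un:
  assumes "piece S" "piece S'" "S \<inter> S' = {}"
  shows "piece (S \<union> S')"
proof -
  obtain \<I> where I: "finite \<I>" "disjoint \<I>" "\<forall>I\<in>\<I>. is_interval I \<and> I \<subseteq> {0..1}" "S = \<Union>\<I>"
    using assms(1) by (auto simp: piece_def)
  obtain \<J> where J: "finite \<J>" "disjoint \<J>" "\<forall>I\<in>\<J>. is_interval I \<and> I \<subseteq> {0..1}" "S' = \<Union>\<J>"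
    using assms(2) by (auto simp: piece_def)
  have "disjoint (\<I> \<union> \<J>)"
    using I J assms(3) by (intro disjoint_union) auto
  then show ?thesis
    unfolding piece_def using I J by (intro exI[of _ "\<I> \<union> \<J>"]) auto
qed

lemma piece_UNION:
  assumes "finite K" "\<And>k. k \<in> K \<Longrightarrow> piece (Y k)" "disjoint_family_on Y K"
  shows "piece (\<Union>k\<in>K. Y k)"
  using assms
proof (induction K)
  case (insert k K)
  then have "Y k \<inter> (\<Union>k\<in>K. Y k) = {}"
    by (auto simp: disjoint_family_on_def)
  then show ?case
    using insert by (simp add: piece_Un disjoint_family_on_insert)
qed simp

lemma sets_piece: "piece S \<Longrightarrow> S \<in> sets lebesgue"
  unfolding piece_def
  by (metis (no_types, lifting) bounded_closed_interval bounded_subset fmeasurableD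
      is_interval_convex measurable_convex sets.finite_Union subsetI)

lemma set_integrable_piece:
  fixes f :: "real \<Rightarrow> real"
  assumes "set_integrable lebesgue {0..1} f" "piece S"
  shows "set_integrable lebesgue S f"
  by (rule set_integrable_subset[OF assms(1) sets_piece piece_subset]) (rule assms)+

lemma valuation_empty [simp]: "valuation f {} = 0"
  by (simp add: valuation_def set_lebesgue_integral_def)

lemma valuation_nonneg:
  assumes "\<And>x. x \<in> {0..1} \<Longrightarrow> f x \<ge> 0" "piece S"
  shows "valuation f S \<ge> 0"
  unfolding valuation_def set_lebesgue_integral_def
  using assms(1) piece_subset[OF assms(2)]
  by (intro Bochner_Integration.integral_nonneg) (auto simp: indicator_def)

lemma valuation_Un:
  assumes "set_integrable lebesgue {0..1} f" "piece S" "piece S'" "S \<inter> S' = {}"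
  shows "valuation f (S \<union> S') = valuation f S + valuation f S'"
  unfolding valuation_def
  by (rule set_integral_Un) (use assms set_integrable_piece in auto)

lemma valuation_UNION:
  assumes f: "set_integrable lebesgue {0..1} f"
    and K: "finite K" "\<And>k. k \<in> K \<Longrightarrow> piece (Y k)" "disjoint_family_on Y K"
  shows "valuation f (\<Union>k\<in>K. Y k) = (\<Sum>k\<in>K. valuation f (Y k))"
  using K
proof (induction K)
  case (insert k K)
  then have "Y k \<inter> (\<Union>k\<in>K. Y k) = {}"
    by (auto simp: disjoint_family_on_def)
  then show ?case
    using insert f by (simp add: valuation_Un piece_UNION disjoint_family_on_insert)
qed simp

section \<open>Equal division by the intermediate value theorem\<close>

lemma continuous_on_valuation_atMost:
  assumes f: "set_integrable lebesgue {0..1} f" and X: "piece X"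
  shows "continuous_on {-1..b} (\<lambda>t. valuation f (X \<inter> {..t}))"
proof -
  let ?g = "\<lambda>x. indicator X x *\<^sub>R f x"
  have int: "set_integrable lebesgue X f" by (rule set_integrable_piece[OF f X])
  \<comment> \<open>Starting at -1, strictly left of the cake, makes the accumulated value start at
    0 and later lets a half-open slice contain the point 0.\<close>
  have eq: "valuation f (X \<inter> {..t}) = integral {-1..t} ?g" for t
  proof -
    have "piece (X \<inter> {..t})" by (rule piece_Int_interval[OF X is_interval_ic])
    then have "set_integrable lebesgue (X \<inter> {..t}) f" by (rule set_integrable_piece[OF f])
    moreover have "(\<lambda>x. indicator (X \<inter> {..t}) x *\<^sub>R f x) = (\<lambda>x. indicator {-1..t} x *\<^sub>R ?g x)"
      using piece_subset[OF X] by (force simp: indicator_def)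
    ultimately have "set_integrable lebesgue {-1..t} ?g"
      and "valuation f (X \<inter> {..t}) = set_lebesgue_integral lebesgue {-1..t} ?g"
      by (simp_all add: set_integrable_def valuation_def set_lebesgue_integral_def)
    then show ?thesis by (simp add: set_lebesgue_integral_eq_integral)
  qed
  have "?g absolutely_integrable_on UNIV"
    using int by (simp add: set_integrable_def)
  then have "?g integrable_on UNIV" by (rule set_lebesgue_integral_eq_integral)
  then have "?g integrable_on {-1..b}" by (rule integrable_on_subinterval) simp
  then show ?thesis
    unfolding eq by (rule indefinite_integral_continuous_1)
qed

text \<open>The accumulated value \<open>F\<close> is continuous and runs from 0 to
  \<open>m * c\<close>. The intermediate value theorem marks, from left to right, points where it
  reaches the multiples of \<open>c\<close>; consecutive marks bound the slices.\<close>

lemma equal_slicing: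
  assumes f: "set_integrable lebesgue {0..1} f" and f0: "\<And>x. x \<in> {0..1} \<Longrightarrow> f x \<ge> 0"
    and X: "piece X" and m: "m > 0"
  obtains C Y where "slicing X C m Y" "\<forall>k<m. \<forall>l<m. valuation f (Y k) = valuation f (Y l)"
proof -
  define F where "F t = valuation f (X \<inter> {..t})" for t
  define c where "c = valuation f X / m"
  have X01: "X \<subseteq> {0..1}" by (rule piece_subset[OF X])
  have c0: "c \<ge> 0" using valuation_nonneg[OF f0 X] by (simp add: c_def)
  have Fm1: "F (-1) = 0"
  proof -
    have "X \<inter> {..-1} = {}" using X01 by force
    then show ?thesis by (simp add: F_def)
  qed
  have F1: "F 1 = m * c"
  proof -
    have "X \<inter> {..1} = X" using X01 by force
    then show ?thesis using m by (simp add: F_def c_def)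
  qed
  have contF: "continuous_on {a..b} F" if "-1 \<le> a" for a b
    unfolding F_def
    by (rule continuous_on_subset[OF continuous_on_valuation_atMost[OF f X]]) (use that in auto)
  \<comment> \<open>\<open>min n m\<close> keeps the target within the range of \<open>F\<close>, so
    that the choice can go on for every \<open>n\<close>. The last conjunct pins the first mark left
    of the cake.\<close>
  let ?P = "\<lambda>n x. x \<in> {-1..1} \<and> F x = real (min n m) * c \<and> (n = 0 \<longrightarrow> x = -1)"
  have "\<exists>t. \<forall>n. ?P n (t n) \<and> t n \<le> t (Suc n)"
  proof (rule dependent_nat_choice)
    show "\<exists>x. ?P 0 x" using Fm1 by auto
    fix x n assume x: "?P n x"
    have "real (min n m) * c \<le> real (min (Suc n) m) * c" "real (min (Suc n) m) * c \<le> m * c"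
      using c0 by (auto intro!: mult_right_mono)
    then obtain y where "x \<le> y" "y \<le> 1" "F y = real (min (Suc n) m) * c"
      using IVT'[of F x "real (min (Suc n) m) * c" 1] x F1 contF[of x 1] by auto
    then show "\<exists>y. ?P (Suc n) y \<and> x \<le> y" using x by (intro exI[of _ y]) auto
  qed
  then obtain t where t: "\<And>n. ?P n (t n)" "\<And>n. t n \<le> t (Suc n)" by blast
  \<comment> \<open>\<open>t m\<close> may lie left of 1 when the end of \<open>X\<close> is
    worthless; replacing it by 1 gives that remainder to the last slice without changing any
    value.\<close>
  define s where "s k = (if k < m then t k else 1)" for k
  have s0: "s 0 = -1" and sm: "s m = 1" using t(1)[of 0] m by (auto simp: s_def)
  have s_Suc: "s k \<le> s (Suc k)" for k using t(1)[of k] t(2)[of k] by (auto simp: s_def)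
  then have s_mono: "mono s" by (simp add: mono_iff_le_Suc)
  have Fs: "F (s k) = k * c" if "k \<le> m" for k
    using that t(1)[of k] F1 by (auto simp: s_def)
  define Y where "Y k = X \<inter> {s k<..s (Suc k)}" for k
  have pieceY: "piece (Y k)" for k
    unfolding Y_def by (rule piece_Int_interval[OF X is_interval_oc])
  have YF: "valuation f (Y k) = F (s (Suc k)) - F (s k)" for k
  proof -
    have "X \<inter> {..s (Suc k)} = (X \<inter> {..s k}) \<union> Y k"
      using s_Suc[of k] by (auto simp: Y_def)
    moreover have "(X \<inter> {..s k}) \<inter> Y k = {}" by (auto simp: Y_def)
    ultimately show ?thesis
      using valuation_Un[OF f piece_Int_interval[OF X is_interval_ic] pieceY]
      by (simp add: F_def)
  qed
  have Yc: "valuation f (Y k) = c" if "k < m" for k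
    using that by (simp add: YF Fs algebra_simps)
  have disjY: "disjoint_family_on Y {..<m}"
    unfolding disjoint_family_on_def
  proof (intro ballI impI)
    have *: "Y k \<inter> Y l = {}" if "k < l" for k l
      using monoD[OF s_mono, of "Suc k" l] that by (fastforce simp: Y_def)
    show "Y k \<inter> Y l = {}" if "k \<noteq> l" for k l
      using that *[of k l] *[of l k] by (cases "k < l") auto
  qed
  have coverY: "(\<Union>k<m. Y k) = X"
  proof (intro equalityI subsetI)
    fix x assume x: "x \<in> X"
    then have "x \<le> s m" using X01 sm by auto
    define j where "j = (LEAST j. x \<le> s j)"
    have j: "x \<le> s j" unfolding j_def by (rule LeastI) (rule \<open>x \<le> s m\<close>)
    have "j \<noteq> 0" using j x X01 s0 by (cases j) force+
    then obtain k where k: "j = Suc k" by (cases j) auto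
    have "j \<le> m" unfolding j_def by (rule Least_le) (rule \<open>x \<le> s m\<close>)
    moreover have "\<not> x \<le> s k" using not_less_Least[of k "\<lambda>j. x \<le> s j"] k j_def by auto
    ultimately show "x \<in> (\<Union>k<m. Y k)" using x j k by (auto simp: Y_def intro!: bexI[of _ k])
  qed (auto simp: Y_def)
  \<comment> \<open>The outer marks -1 and 1 need no cut, which leaves at most \<open>m - 1\<close>
    points; marks outside \<open>X\<close> divide nothing and are dropped.\<close>
  define C where "C = X \<inter> s ` {1..<m}"
  have "card C \<le> card (s ` {1..<m})" unfolding C_def by (rule card_mono) auto
  also have "\<dots> \<le> card {1..<m}" by (rule card_image_le) simp
  finally have cardC: "card C < m" using m by simp
  have comp: "\<exists>k<m. K \<subseteq> Y k" if K: "K \<in> components (X - C)" for K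
  proof -
    have KX: "K \<subseteq> X - C" by (rule in_components_subset[OF K])
    have interval: "is_interval K"
      using in_components_connected[OF K] by (simp add: is_interval_connected_1)
    obtain x where x: "x \<in> K" using in_components_nonempty[OF K] by auto
    then obtain k where k: "k < m" "x \<in> Y k" using KX coverY by auto
    have K01: "0 \<le> z \<and> z \<le> 1" if "z \<in> K" for z using that KX X01 by auto
    \<comment> \<open>\<open>s 0\<close> is off the cake, and every other such mark is a cut point
      or lies outside \<open>X\<close>. An interval avoiding these marks cannot leave its slice: the
      only remaining mark is \<open>s m\<close>, which no point of \<open>K\<close> exceeds.\<close>
    have notin: "s l \<notin> K" if "l < m" for l
    proof
      assume l: "s l \<in> K"
      then have "l \<noteq> 0" using K01[OF l] s0 by (cases l) auto
      then have "s l \<in> C" using l KX that by (auto simp: C_def)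
      then show False using l KX by auto
    qed
    have "y \<in> Y k" if y: "y \<in> K" for y
    proof (rule ccontr)
      assume "y \<notin> Y k"
      then have "y \<le> s k \<or> s (Suc k) < y" using y KX by (auto simp: Y_def)
      then show False
      proof
        assume "y \<le> s k"
        moreover have "s k \<le> x" using k by (simp add: Y_def)
        ultimately have "s k \<in> K" using interval x y unfolding is_interval_1 by blast
        then show False using notin k by blast
      next
        assume *: "s (Suc k) < y"
        moreover have "x \<le> s (Suc k)" using k by (simp add: Y_def)
        ultimately have "s (Suc k) \<in> K"
          using interval x y unfolding is_interval_1 by (meson less_imp_le)
        then have "\<not> Suc k < m" using notin by blast
        then have "Suc k = m" using k(1) by simp
        then show False using * sm K01[OF y] by simp
      qed
    qed
    then show ?thesis using k by blast
  qed
  have "slicing X C m Y"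
    unfolding slicing_def using cardC pieceY disjY coverY comp by (auto simp: C_def)
  then show ?thesis using that Yc by simp
qed

lemma exists_top_subset:
  fixes g :: "'b \<Rightarrow> real"
  assumes "finite U" "p \<le> card U"
  shows "\<exists>K\<subseteq>U. card K = p \<and> (\<forall>k\<in>K. \<forall>l\<in>U - K. g l \<le> g k)"
  using assms(2)
proof (induction p)
  case (Suc p)
  then obtain K where K: "K \<subseteq> U" "card K = p" "\<forall>k\<in>K. \<forall>l\<in>U - K. g l \<le> g k" by auto
  have finK: "finite K" using K assms finite_subset by blast
  have "U - K \<noteq> {}"
    using Suc.prems K card_mono[OF finK, of U] by auto
  then have "Max (g ` (U - K)) \<in> g ` (U - K)" using assms(1) by (intro Max_in) auto
  then obtain a where a: "a \<in> U - K" "g a = Max (g ` (U - K))" by auto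
  then have "\<forall>l\<in>U - K. g l \<le> g a" using assms(1) by simp
  then show ?case using a(1) K finK by (intro exI[of _ "insert a K"]) auto
qed (intro exI[of _ "{}"], simp)

section \<open>Invariant of the algorithm\<close>

locale cake_sharing = rooted_tree T r for T :: "'a pair_pre_digraph" and r :: 'a +
  fixes \<rho> :: "'a \<Rightarrow> real \<Rightarrow> real"
  assumes integrable: "i \<in> pverts T \<Longrightarrow> set_integrable lebesgue {0..1} (\<rho> i)"
    and nonneg: "i \<in> pverts T \<Longrightarrow> x \<in> {0..1} \<Longrightarrow> \<rho> i x \<ge> 0"
begin

abbreviation "val i \<equiv> valuation (\<rho> i)"

text \<open>An ancestor is counted only once she is in \<open>D\<close>, because before that her
  cake is still to be shared out. With all vertices in \<open>D\<close> the sums cover exactly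
  \<open>i\<close> and her neighbors in the descendant graph.\<close>

definition burden :: "('a \<Rightarrow> real set) \<Rightarrow> 'a set \<Rightarrow> 'a \<Rightarrow> real" where
  "burden H D i = (\<Sum>j\<in>sub i. val i (H j)) + (\<Sum>j\<in>D \<inter> ancestors i. val i (H j))"

definition closed_under_ancestors :: "'a set \<Rightarrow> bool" where
  "closed_under_ancestors D \<longleftrightarrow> (\<forall>v\<in>D. ancestors v \<subseteq> D)"

text \<open>For \<open>D = V\<close> the bound on processed agents becomes proportionality:
  \<open>dep i + card (sub i)\<close> is one more than the degree, and \<open>burden\<close>
  includes \<open>i\<close> herself. An unprocessed agent still holds all she has collected and
  satisfies the smaller factor \<open>dep i + 1\<close>; the factor grows when she keeps only
  \<open>fact maxdep\<close> of her slices.\<close>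

definition ready_inv :: "'a set \<Rightarrow> ('a \<Rightarrow> real set) \<Rightarrow> nat \<Rightarrow> bool" where
  "ready_inv D H c \<longleftrightarrow>
     D \<subseteq> V \<and> closed_under_ancestors D \<and> allocation V H \<and> real c \<le> (\<Sum>v\<in>D. slices v) \<and>
     (\<forall>i\<in>D. burden H D i \<le> real (dep i + card (sub i)) * val i (H i)) \<and>
     (\<forall>i\<in>V - D. burden H D i \<le> real (dep i + 1) * val i (H i))"

text \<open>
  Here \<open>H u\<close> consists of the slices not yet taken, whereas in the state \<open>Distributing D H c u Y U W\<close>
  it is still the whole cake that \<open>u\<close> collected. An agent \<open>i\<close> who has already chosen carries a
  bound \<open>\<beta>\<close>, the average value to her of the slices she took, for the remaining ones; it pays in advance
  for the slices that her descendants will take and for the \<open>d!\<close> slices that \<open>u\<close> keeps.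
\<close>

definition distributing_inv ::
    "'a set \<Rightarrow> ('a \<Rightarrow> real set) \<Rightarrow> nat \<Rightarrow> 'a \<Rightarrow> (nat \<Rightarrow> real set) \<Rightarrow> nat set \<Rightarrow> 'a set \<Rightarrow> bool" where
  "distributing_inv D H c u Y U W \<longleftrightarrow>
     D \<subseteq> V \<and> closed_under_ancestors D \<and> u \<in> V - D \<and> ancestors u \<subseteq> D \<and>
     W \<subseteq> sub u - {u} \<and> (\<forall>w\<in>W. sub w \<subseteq> W) \<and>
     allocation V H \<and> H u = (\<Union>k\<in>U. Y k) \<and>
     finite U \<and> (\<forall>k\<in>U. piece (Y k)) \<and> disjoint_family_on Y U \<and>
     real (card U) = fact maxdep + (\<Sum>w\<in>W. share w) \<and>
     real c \<le> slices u + (\<Sum>v\<in>D. slices v) \<and>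
     (\<exists>y. (\<forall>k\<in>U. val u (Y k) = y) \<and> burden H D u \<le> real (dep u + 1) * (slices u * y)) \<and>
     (\<forall>i\<in>D. burden H D i \<le> real (dep i + card (sub i)) * val i (H i)) \<and>
     (\<forall>i\<in>V - D - sub u \<union> W. burden H D i \<le> real (dep i + 1) * val i (H i)) \<and>
     (\<forall>i\<in>sub u - {u} - W. \<exists>\<beta>. (\<forall>k\<in>U. val i (Y k) \<le> \<beta>) \<and>
        burden H D i + ((\<Sum>w\<in>W \<inter> sub i. share w) + fact maxdep) * \<beta>
          \<le> real (dep i + 1) * val i (H i))"

fun state_inv :: "'a state \<Rightarrow> bool" where
  "state_inv (Ready D H c) = ready_inv D H c"
| "state_inv (Distributing D H c u Y U W) = distributing_inv D (H(u := \<Union>k\<in>U. Y k)) c u Y U W"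

lemma allocation_piece: "allocation V H \<Longrightarrow> j \<in> V \<Longrightarrow> piece (H j)"
  by (simp add: allocation_def)

lemma slices_eq: "v \<in> V \<Longrightarrow> slices v = fact maxdep + (\<Sum>w\<in>sub v - {v}. share w)"
  using sum_share by simp

lemma real_depth_mult_share: "dep v > 0 \<Longrightarrow> real (dep v) * share v = slices v"
  by (simp add: share_def)

lemma val_UNION:
  assumes "i \<in> V" "finite K" "\<forall>k\<in>K. piece (Y k)" "disjoint_family_on Y K"
  shows "val i (\<Union>k\<in>K. Y k) = (\<Sum>k\<in>K. val i (Y k))"
  using assms by (intro valuation_UNION integrable) auto

lemma not_in_sub_if_ancestors_closed:
  assumes "closed_under_ancestors D" "u \<notin> D" "v \<in> sub u" 
  shows "v \<notin> D"
  using assms by (auto simp: closed_under_ancestors_def ancestors_def mem_sub_iff)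

section \<open>Preservation of the invariant\<close>

lemma initial_inv: "state_inv (initial_state r)"
proof -
  let ?H = "\<lambda>i. if i = r then {0..1} else {} :: real set"
  have "allocation V ?H"
    using root_in_verts by (auto simp: allocation_def piece_unit_interval disjoint_family_on_def)
  moreover have "burden ?H {} i \<le> real (dep i + 1) * val i (?H i)" if i: "i \<in> V" for i
  proof (cases "i = r")
    case True
    have "(\<Sum>j\<in>sub r. val r (?H j)) = (\<Sum>j\<in>V. if j = r then val r {0..1} else 0)"
      unfolding sub_root by (intro sum.cong) auto
    then have "(\<Sum>j\<in>sub r. val r (?H j)) = val r {0..1}"
      using root_in_verts pair_finite_verts by simp
    then show ?thesis using True by (simp add: burden_def depth_root)
  next
    case False
    then have "r \<notin> sub i"
      using ancestors_root by (auto simp: mem_sub_iff ancestors_def)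
    then have "(\<Sum>j\<in>sub i. val i (?H j)) = 0"
      by (intro sum.neutral) auto
    then show ?thesis using False by (simp add: burden_def)
  qed
  ultimately show ?thesis
    by (simp add: initial_state_def ready_inv_def closed_under_ancestors_def)
qed

text \<open>No cake changes hands. The bound for \<open>u\<close> is restated through the common
  slice value \<open>y\<close>, since \<open>slices u * y\<close> stays fixed while her holding
  shrinks. Nobody has chosen yet, so the bounds with \<beta> are vacuous.\<close>

lemma cut_inv:
  assumes inv: "ready_inv D H c" and u: "u \<in> V - D"
    and least: "\<forall>w\<in>V - D. dep u \<le> dep w"
    and m: "real m = slices u" and sl: "slicing (H u) C m Y"
    and eq: "\<forall>k<m. \<forall>l<m. val u (Y k) = val u (Y l)"
  shows "distributing_inv D H (c + card C) u Y {..<m} (sub u - {u})"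
proof -
  from inv have D: "D \<subseteq> V" "closed_under_ancestors D" and H: "allocation V H"
    and c: "real c \<le> (\<Sum>v\<in>D. slices v)"
    and b1: "\<forall>i\<in>D. burden H D i \<le> real (dep i + card (sub i)) * val i (H i)"
    and b2: "\<forall>i\<in>V - D. burden H D i \<le> real (dep i + 1) * val i (H i)"
    by (auto simp: ready_inv_def)
  from sl have C: "card C < m" and Y: "\<forall>k<m. piece (Y k)" "disjoint_family_on Y {..<m}"
    and Hu: "H u = (\<Union>k<m. Y k)" by (auto simp: slicing_def)
  have anc_u: "ancestors u \<subseteq> D"
  proof
    fix a assume "a \<in> ancestors u"
    then have "a \<in> V" "dep a < dep u" using u anc_depth anc_in_verts by (auto simp: ancestors_def)
    then show "a \<in> D" using least by force
  qed
  obtain y where y: "\<And>k. k < m \<Longrightarrow> val u (Y k) = y"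
    using eq by blast
  have "val u (H u) = (\<Sum>k<m. val u (Y k))"
    using val_UNION[of u "{..<m}" Y] u Y Hu by simp
  also have "\<dots> = (\<Sum>k<m. y)"
    by (rule sum.cong) (simp_all add: y)
  finally have val_u: "val u (H u) = slices u * y" using m by simp
  have "burden H D u \<le> real (dep u + 1) * val u (H u)" using b2 u by blast
  then have common: "\<exists>y. (\<forall>k\<in>{..<m}. val u (Y k) = y) \<and> burden H D u \<le> real (dep u + 1) * (slices u * y)"
    using y unfolding val_u by blast
  have closed: "\<forall>w\<in>sub u - {u}. sub w \<subseteq> sub u - {u}"
    using sub_proper_descendant u by blast
  have "i \<in> V - D" if "i \<in> V - D - sub u \<union> (sub u - {u})" for i
    using that u sub_subset[of u] not_in_sub_if_ancestors_closed[OF D(2), of u i] by auto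
  with b2 have b2': "\<forall>i\<in>V - D - sub u \<union> (sub u - {u}).
      burden H D i \<le> real (dep i + 1) * val i (H i)" by blast
  have card: "real (card {..<m}) = fact maxdep + (\<Sum>w\<in>sub u - {u}. share w)"
    using m slices_eq[of u] u by simp
  have c': "real (c + card C) \<le> slices u + (\<Sum>v\<in>D. slices v)"
    using c C m by linarith
  show ?thesis
    unfolding distributing_inv_def
    using D u anc_u closed H Hu Y card c' common b1 b2' by auto
qed

text \<open>Cake moves from \<open>u\<close> to \<open>v\<close>. An agent whose subtree contains
  both or neither of the two keeps her burden. It can grow only for \<open>v\<close>, whose own pick
  pays for it, and for the agents strictly between \<open>u\<close> and \<open>v\<close>, who chose
  earlier because choices go by depth, and who have prepaid.\<close>

lemma take_inv:
  assumes inv: "distributing_inv D H c u Y U W" and v: "v \<in> W"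
    and least: "\<forall>w\<in>W. dep v \<le> dep w"
    and K: "K \<subseteq> U" "real (card K) = share v"
    and best: "\<forall>k\<in>K. \<forall>l\<in>U - K. val v (Y l) \<le> val v (Y k)"
  shows "distributing_inv D (H(v := H v \<union> (\<Union>k\<in>K. Y k), u := (\<Union>k\<in>U - K. Y k))) c u Y (U - K) (W - {v})"
    (is "distributing_inv D ?H c u Y _ _")
proof -
  from inv have D: "D \<subseteq> V" "closed_under_ancestors D" and u: "u \<in> V" "u \<notin> D" "ancestors u \<subseteq> D"
    and W: "W \<subseteq> sub u - {u}" "\<forall>w\<in>W. sub w \<subseteq> W"
    and H: "allocation V H" and Hu: "H u = (\<Union>k\<in>U. Y k)"
    and U: "finite U" "\<forall>k\<in>U. piece (Y k)" "disjoint_family_on Y U"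
    and cardU: "real (card U) = fact maxdep + (\<Sum>w\<in>W. share w)"
    and c: "real c \<le> slices u + (\<Sum>v\<in>D. slices v)"
    and y: "\<exists>y. (\<forall>k\<in>U. val u (Y k) = y) \<and> burden H D u \<le> real (dep u + 1) * (slices u * y)"
    and b1: "\<forall>i\<in>D. burden H D i \<le> real (dep i + card (sub i)) * val i (H i)"
    and b2: "\<forall>i\<in>V - D - sub u \<union> W. burden H D i \<le> real (dep i + 1) * val i (H i)"
    and b3: "\<forall>i\<in>sub u - {u} - W. \<exists>\<beta>. (\<forall>k\<in>U. val i (Y k) \<le> \<beta>) \<and>
        burden H D i + ((\<Sum>w\<in>W \<inter> sub i. share w) + fact maxdep) * \<beta>
          \<le> real (dep i + 1) * val i (H i)"
    by (auto simp: distributing_inv_def)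
  define \<kappa> where "\<kappa> i = (\<Sum>k\<in>K. val i (Y k))" for i
  have vu: "v \<noteq> u" "v \<in> sub u" "v \<in> V" "anc u v" and WV: "W \<subseteq> V"
    using v W sub_subset[OF u(1)] by (auto simp: mem_sub_iff)
  have vD: "v \<notin> D" using not_in_sub_if_ancestors_closed[OF D(2) u(2) vu(2)] .
  have finW: "finite W" using WV pair_finite_verts finite_subset by blast
  have finK: "finite K" using K U finite_subset by blast
  have pK: "\<forall>k\<in>K. piece (Y k)" "disjoint_family_on Y K"
    using K U by (auto intro: disjoint_family_on_mono)
  have pR: "\<forall>k\<in>U - K. piece (Y k)" "disjoint_family_on Y (U - K)"
    using U by (auto intro: disjoint_family_on_mono)
  have split: "H u = (\<Union>k\<in>K. Y k) \<union> (\<Union>k\<in>U - K. Y k)" using Hu K by auto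
  have disjKR: "(\<Union>k\<in>K. Y k) \<inter> (\<Union>k\<in>U - K. Y k) = {}"
    using U(3) K(1) by (fastforce simp: disjoint_family_on_def)
  have disjH: "H i \<inter> H j = {}" if "i \<in> V" "j \<in> V" "i \<noteq> j" for i j
    using H that by (auto simp: allocation_def disjoint_family_on_def)
  have disjv: "H v \<inter> (\<Union>k\<in>K. Y k) = {}" using disjH[of v u] u vu split by auto
  have pieceK: "piece (\<Union>k\<in>K. Y k)" using finK pK by (intro piece_UNION) auto
  have pieceR: "piece (\<Union>k\<in>U - K. Y k)" using U pR by (intro piece_UNION) auto
  have alloc: "allocation V ?H"
  proof -
    have "piece (?H i)" if "i \<in> V" for i
      using that pieceK pieceR disjv vu allocation_piece[OF H] by (auto intro: piece_Un)
    moreover have "disjoint_family_on ?H V"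
      unfolding disjoint_family_on_def
    proof (intro ballI impI)
      fix i j assume ij: "i \<in> V" "j \<in> V" "i \<noteq> j"
      show "?H i \<inter> ?H j = {}"
        using disjH[OF ij] disjH[of i u] disjH[of j u] disjH[of v u] ij u vu split disjKR
        by auto
    qed
    moreover have "(\<Union>i\<in>V. ?H i) = (\<Union>i\<in>V. H i)"
    proof -
      have V: "V = insert u (insert v (V - {u, v}))" using u vu by auto
      have "(\<Union>i\<in>V - {u, v}. ?H i) = (\<Union>i\<in>V - {u, v}. H i)" by auto
      then show ?thesis
        using vu split by (subst (1 2) V) auto
    qed
    ultimately show ?thesis using H by (simp add: allocation_def)
  qed
  have val_v: "val i (?H v) = val i (H v) + \<kappa> i" if "i \<in> V" for i
    using that vu integrable allocation_piece[OF H] pieceK disjv finK pK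
    by (simp add: valuation_Un val_UNION \<kappa>_def)
  have val_u: "val i (?H u) = val i (H u) - \<kappa> i" if "i \<in> V" for i
    using that integrable pieceK pieceR disjKR finK pK unfolding split
    by (simp add: valuation_Un val_UNION[OF that finK pK] \<kappa>_def)
  have sum_upd: "(\<Sum>j\<in>J. val i (?H j)) = (\<Sum>j\<in>J. val i (H j))
      + (if v \<in> J then \<kappa> i else 0) - (if u \<in> J then \<kappa> i else 0)"
    if "finite J" "i \<in> V" for J i
  proof -
    have "(\<Sum>j\<in>J. val i (?H j)) = (\<Sum>j\<in>J. val i (H j) + (if j = v then \<kappa> i else 0) - (if j = u then \<kappa> i else 0))"
      using val_v[OF that(2)] val_u[OF that(2)] vu by (intro sum.cong) auto
    then show ?thesis using that(1) by (simp add: sum.distrib sum_subtractf)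
  qed
  \<comment> \<open>Neither \<open>u\<close> nor \<open>v\<close> is in \<open>D\<close>, so the
    transfer only shows in the sum over the subtree.\<close>
  have burden_upd: "burden ?H D i = burden H D i
      + (if v \<in> sub i then \<kappa> i else 0) - (if u \<in> sub i then \<kappa> i else 0)" if "i \<in> V" for i
    using that u vD finite_sub[OF that] finite_ancestors[of i] sum_upd[of "sub i" i] sum_upd[of "D \<inter> ancestors i" i]
    unfolding burden_def by auto
  have u_notin_sub: "u \<notin> sub i" if "i \<notin> D" "i \<noteq> u" for i
    using that u(3) by (auto simp: mem_sub_iff ancestors_def)
  have y': "\<exists>y. (\<forall>k\<in>U - K. val u (Y k) = y) \<and> burden ?H D u \<le> real (dep u + 1) * (slices u * y)"
    using y burden_upd[OF u(1)] vu by (auto simp: mem_sub_iff)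
  \<comment> \<open>\<open>i\<close> is no descendant of \<open>u\<close>; if \<open>v\<close> is
    below \<open>i\<close>, then linearity puts \<open>u\<close> below \<open>i\<close> as well, and
    the burden is unchanged.\<close>
  have b1': "\<forall>i\<in>D. burden ?H D i \<le> real (dep i + card (sub i)) * val i (?H i)"
  proof
    fix i assume i: "i \<in> D"
    then have iV: "i \<in> V" and ne: "i \<noteq> u" "i \<noteq> v" using D u vD by auto
    have "\<not> anc u i" using i D(2) u(2) by (auto simp: closed_under_ancestors_def ancestors_def)
    then have "v \<in> sub i \<longleftrightarrow> u \<in> sub i"
      using ne vu u anc_linear[of i v u] anc_trans[of i u v] by (auto simp: mem_sub_iff)
    then show "burden ?H D i \<le> real (dep i + card (sub i)) * val i (?H i)"
      using b1 i burden_upd[OF iV] ne by auto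
  qed
  have b2': "\<forall>i\<in>V - D - sub u \<union> (W - {v}). burden ?H D i \<le> real (dep i + 1) * val i (?H i)"
  proof
    fix i assume i: "i \<in> V - D - sub u \<union> (W - {v})"
    then have iV: "i \<in> V" "i \<notin> D" "i \<noteq> u"
      using WV W not_in_sub_if_ancestors_closed[OF D(2) u(2), of i] by (auto simp: mem_sub_iff)
    have ne: "i \<noteq> v" using i vu by auto
    \<comment> \<open>An agent other than \<open>u\<close> above \<open>v\<close> is either above
      \<open>u\<close>, hence processed, or below \<open>u\<close> with smaller depth than
      \<open>v\<close>, hence no longer in \<open>W\<close>.\<close>
    have "v \<notin> sub i"
    proof
      assume "v \<in> sub i"
      then have iv: "anc i v" using ne by (auto simp: mem_sub_iff)
      show False
      proof (cases "i \<in> W")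
        case True
        then show False using least anc_depth[OF iv vu(3)] by force
      next
        case False
        then have "\<not> anc u i" using i by (auto simp: mem_sub_iff)
        then have "anc i u" using anc_linear[OF iv vu(4,3)] iV by auto
        then show False using u(3) iV by (auto simp: ancestors_def)
      qed
    qed
    then show "burden ?H D i \<le> real (dep i + 1) * val i (?H i)"
      using b2 i burden_upd[OF iV(1)] u_notin_sub[OF iV(2,3)] ne iV by auto
  qed
  have dep_v: "dep v > 0" by (rule depth_pos[OF vu(3,4)])
  have share_v: "share v > 0" by (rule share_pos[OF vu(3) dep_v])
  have b3': "\<exists>\<beta>. (\<forall>k\<in>U - K. val i (Y k) \<le> \<beta>) \<and>
        burden ?H D i + ((\<Sum>w\<in>(W - {v}) \<inter> sub i. share w) + fact maxdep) * \<beta>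
          \<le> real (dep i + 1) * val i (?H i)" if i: "i \<in> sub u - {u} - (W - {v})" for i
  proof (cases "i = v")
    case True
    define \<beta> where "\<beta> = \<kappa> v / share v"
    have "val v (Y l) \<le> \<beta>" if l: "l \<in> U - K" for l
    proof -
      have "(\<Sum>k\<in>K. val v (Y l)) \<le> \<kappa> v"
        unfolding \<kappa>_def using best l by (intro sum_mono) auto
      then show ?thesis using share_v K(2) by (simp add: \<beta>_def field_simps)
    qed
    \<comment> \<open>The burden grows by \<open>\<kappa> v\<close> and the right-hand side by
      \<open>(dep v + 1) * \<kappa> v\<close>. The difference buys \<open>slices v\<close> slices at
      price \<beta>, because \<open>share v\<close> is \<open>slices v / dep v\<close>; this is the
      number of slices for her descendants plus \<open>fact maxdep\<close>.\<close>
    moreover have "burden ?H D v + ((\<Sum>w\<in>(W - {v}) \<inter> sub v. share w) + fact maxdep) * \<beta>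
          \<le> real (dep v + 1) * val v (?H v)"
    proof -
      have "(W - {v}) \<inter> sub v = sub v - {v}" using W(2) v by auto
      then have "((\<Sum>w\<in>(W - {v}) \<inter> sub v. share w) + fact maxdep) * \<beta> = slices v * \<beta>"
        using slices_eq[OF vu(3)] by simp
      also have "\<dots> = real (dep v) * \<kappa> v"
        using real_depth_mult_share[OF dep_v] share_v by (simp add: \<beta>_def field_simps)
      finally have eq: "((\<Sum>w\<in>(W - {v}) \<inter> sub v. share w) + fact maxdep) * \<beta> = real (dep v) * \<kappa> v" .
      have "burden ?H D v = burden H D v + \<kappa> v"
        using burden_upd[OF vu(3)] u_notin_sub[OF vD vu(1)] v W(2) mem_sub_iff[of v v] by simp
      moreover have "burden H D v \<le> real (dep v + 1) * val v (H v)" using b2 v by auto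
      ultimately show ?thesis unfolding eq val_v[OF vu(3)] by (simp add: algebra_simps)
    qed
    ultimately show ?thesis using True by blast
  next
    case False
    then have i': "i \<in> sub u - {u} - W" using i by auto
    then have iV: "i \<in> V" "i \<notin> D" "i \<noteq> u"
      using sub_subset[OF u(1)] not_in_sub_if_ancestors_closed[OF D(2) u(2), of i] by auto
    obtain \<beta> where \<beta>: "\<forall>k\<in>U. val i (Y k) \<le> \<beta>"
        "burden H D i + ((\<Sum>w\<in>W \<inter> sub i. share w) + fact maxdep) * \<beta>
          \<le> real (dep i + 1) * val i (H i)"
      using b3 i' by blast
    have "\<kappa> i \<le> (\<Sum>k\<in>K. \<beta>)" unfolding \<kappa>_def using \<beta>(1) K(1) by (intro sum_mono) auto
    then have \<kappa>: "\<kappa> i \<le> share v * \<beta>" using K(2) by simp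
    \<comment> \<open>If \<open>v\<close> lies below \<open>i\<close>, the reserve of
      \<open>i\<close> drops by \<open>share v * \<beta>\<close>, which is at least the value
      \<open>\<kappa> i\<close> added to her burden.\<close>
    have "burden ?H D i + ((\<Sum>w\<in>(W - {v}) \<inter> sub i. share w) + fact maxdep) * \<beta>
        \<le> burden H D i + ((\<Sum>w\<in>W \<inter> sub i. share w) + fact maxdep) * \<beta>"
    proof (cases "v \<in> sub i")
      case True
      have "(\<Sum>w\<in>W \<inter> sub i. share w) = share v + (\<Sum>w\<in>W \<inter> sub i - {v}. share w)"
        using finW v True by (intro sum.remove) auto
      moreover have "W \<inter> sub i - {v} = (W - {v}) \<inter> sub i" by auto
      ultimately show ?thesis
        using \<kappa> True burden_upd[OF iV(1)] u_notin_sub[OF iV(2,3)] by (simp add: algebra_simps)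
    next
      case False
      then have "(W - {v}) \<inter> sub i = W \<inter> sub i" by auto
      then show ?thesis
        using False burden_upd[OF iV(1)] u_notin_sub[OF iV(2,3)] by simp
    qed
    then have "burden ?H D i + ((\<Sum>w\<in>(W - {v}) \<inter> sub i. share w) + fact maxdep) * \<beta>
        \<le> real (dep i + 1) * val i (?H i)"
      using \<beta>(2) False iV by simp
    then show ?thesis using \<beta>(1) by blast
  qed
  \<comment> \<open>\<open>v\<close> has least depth in \<open>W\<close>, so no other member of
    \<open>W\<close> has her as a descendant.\<close>
  have W': "\<forall>w\<in>W - {v}. sub w \<subseteq> W - {v}"
  proof (intro ballI)
    fix w assume w: "w \<in> W - {v}"
    have "v \<notin> sub w"
      using w least anc_depth[of w v] vu(3) by (force simp: mem_sub_iff)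
    then show "sub w \<subseteq> W - {v}" using W(2) w by auto
  qed
  have card': "real (card (U - K)) = fact maxdep + (\<Sum>w\<in>W - {v}. share w)"
  proof -
    have "real (card (U - K)) = real (card U) - real (card K)"
      using card_Diff_subset[OF finK K(1)] card_mono[OF U(1) K(1)] by (simp add: of_nat_diff)
    then show ?thesis using cardU K(2) sum.remove[OF finW v, of share] by simp
  qed
  have rest: "u \<in> V - D" "W - {v} \<subseteq> sub u - {u}" "finite (U - K)" "?H u = (\<Union>k\<in>U - K. Y k)"
    using u W U by auto
  have b3'': "\<forall>i\<in>sub u - {u} - (W - {v}). \<exists>\<beta>. (\<forall>k\<in>U - K. val i (Y k) \<le> \<beta>) \<and>
        burden ?H D i + ((\<Sum>w\<in>(W - {v}) \<inter> sub i. share w) + fact maxdep) * \<beta>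
          \<le> real (dep i + 1) * val i (?H i)"
    by (rule ballI) (rule b3')
  show ?thesis
    unfolding distributing_inv_def
    by (intro conjI D u(3) W' rest alloc pR card' c y' b1' b2' b3'')
qed

text \<open>\<open>u\<close> keeps \<open>fact maxdep\<close> slices worth \<open>y\<close> each, so
  \<open>(dep u + 1) * (slices u * y)\<close> equals \<open>dep u + card (sub u)\<close> times her
  final value. For a proper descendant \<open>i\<close>, the last reserve
  \<open>fact maxdep * \<beta>\<close> pays for counting \<open>u\<close> among the processed
  ancestors.\<close>

lemma finish_inv:
  assumes inv: "distributing_inv D H c u Y U {}"
  shows "ready_inv (insert u D) H c"
proof -
  from inv have D: "D \<subseteq> V" "closed_under_ancestors D" and u: "u \<in> V" "u \<notin> D" "ancestors u \<subseteq> D"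
    and H: "allocation V H" and Hu: "H u = (\<Union>k\<in>U. Y k)"
    and U: "finite U" "\<forall>k\<in>U. piece (Y k)" "disjoint_family_on Y U"
    and cardU: "real (card U) = fact maxdep"
    and c: "real c \<le> slices u + (\<Sum>v\<in>D. slices v)"
    and y: "\<exists>y. (\<forall>k\<in>U. val u (Y k) = y) \<and> burden H D u \<le> real (dep u + 1) * (slices u * y)"
    and b1: "\<forall>i\<in>D. burden H D i \<le> real (dep i + card (sub i)) * val i (H i)"
    and b2: "\<forall>i\<in>V - D - sub u. burden H D i \<le> real (dep i + 1) * val i (H i)"
    and b3: "\<forall>i\<in>sub u - {u}. \<exists>\<beta>. (\<forall>k\<in>U. val i (Y k) \<le> \<beta>) \<and>
        burden H D i + fact maxdep * \<beta> \<le> real (dep i + 1) * val i (H i)"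
    by (auto simp: distributing_inv_def)
  have finD: "finite D" using D(1) pair_finite_verts finite_subset by blast
  have val_u: "val i (H u) = (\<Sum>k\<in>U. val i (Y k))" if "i \<in> V" for i
    unfolding Hu using that U by (rule val_UNION)
  have burden_insert: "burden H (insert u D) i = burden H D i + (if anc u i then val i (H u) else 0)" for i
  proof (cases "anc u i")
    case True
    then have "insert u D \<inter> ancestors i = insert u (D \<inter> ancestors i)" by (auto simp: ancestors_def)
    then show ?thesis using True u(2) finD by (simp add: burden_def)
  next
    case False
    then have "insert u D \<inter> ancestors i = D \<inter> ancestors i" by (auto simp: ancestors_def)
    then show ?thesis using False by (simp add: burden_def)
  qed
  have b1': "burden H (insert u D) i \<le> real (dep i + card (sub i)) * val i (H i)" if "i \<in> insert u D" for i
  proof (cases "i = u")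
    case True
    obtain y where y: "\<forall>k\<in>U. val u (Y k) = y" "burden H D u \<le> real (dep u + 1) * (slices u * y)"
      using y by blast
    have "val u (H u) = fact maxdep * y" using val_u[OF u(1)] y(1) cardU by simp
    then have "real (dep u + 1) * (slices u * y) = real (dep u + card (sub u)) * val u (H u)"
      by (simp add: num_slices_def add_nonneg_eq_0_iff)
    then show ?thesis using y(2) True anc_irrefl burden_insert by simp
  next
    case False
    then have "i \<in> D" using that by auto
    moreover have "\<not> anc u i" using D(2) u(2) \<open>i \<in> D\<close>
      by (auto simp: closed_under_ancestors_def ancestors_def)
    ultimately show ?thesis using b1 burden_insert by simp
  qed
  have b2': "burden H (insert u D) i \<le> real (dep i + 1) * val i (H i)" if i: "i \<in> V - insert u D" for i
  proof (cases "anc u i")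
    have iV: "i \<in> V" using i by simp
    case True
    then have "i \<in> sub u - {u}" using i by (auto simp: mem_sub_iff)
    then obtain \<beta> where \<beta>: "\<forall>k\<in>U. val i (Y k) \<le> \<beta>"
        "burden H D i + fact maxdep * \<beta> \<le> real (dep i + 1) * val i (H i)"
      using b3 by blast
    have "val i (H u) \<le> (\<Sum>k\<in>U. \<beta>)" 
      unfolding val_u[OF iV] using \<beta>(1) by (intro sum_mono) auto
    then show ?thesis using \<beta>(2) True burden_insert cardU by simp
  next
    case False
    then show ?thesis using b2 i burden_insert by (auto simp: mem_sub_iff)
  qed
  have "closed_under_ancestors (insert u D)"
    using D(2) u(3) by (auto simp: closed_under_ancestors_def)
  then show ?thesis
    unfolding ready_inv_def using D u H c finD b1' b2' by simp
qed

lemma step_inv: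
  assumes "step T r \<rho> s s'" "state_inv s"
  shows "state_inv s'"
  using assms
proof cases
  case (cut u D m H C Y c)
  have inv: "ready_inv D H c" using assms(2) cut(1) by simp
  have "H(u := \<Union>k<m. Y k) = H"
    using cut(6) by (auto simp: slicing_def)
  then show ?thesis
    unfolding cut(2) state_inv.simps using cut_inv[OF inv cut(3-7)] by simp
next
  case (take v W K U Y D H c u)
  let ?H = "H(u := \<Union>k\<in>U. Y k)"
  have inv: "distributing_inv D ?H c u Y U W" using assms(2) take(1) by simp
  then have "W \<subseteq> sub u - {u}" unfolding distributing_inv_def by blast
  then have "v \<noteq> u" using take(3) by blast
  then have "?H(v := ?H v \<union> (\<Union>k\<in>K. Y k), u := (\<Union>k\<in>U - K. Y k))
      = H(v := H v \<union> (\<Union>k\<in>K. Y k), u := (\<Union>k\<in>U - K. Y k))"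
    by (auto simp: fun_eq_iff)
  then show ?thesis
    unfolding take(2) state_inv.simps
    using take_inv[OF inv take(3-5) _ take(7)] take(6) by (simp only: share_def)
next
  case (finish D H c u Y U)
  have "distributing_inv D (H(u := \<Union>k\<in>U. Y k)) c u Y U {}" using assms(2) finish(1) by simp
  then show ?thesis unfolding finish(2) state_inv.simps by (rule finish_inv)
qed

lemma reachable_inv: "(step T r \<rho>)\<^sup>*\<^sup>* (initial_state r) s \<Longrightarrow> state_inv s"
  by (induction rule: rtranclp_induct) (auto intro: initial_inv step_inv)

section \<open>Termination and progress\<close>

fun remaining :: "'a state \<Rightarrow> nat" where
  "remaining (Ready D H c) = card (V - D) * (card V + 2)"
| "remaining (Distributing D H c u Y U W) = card (V - insert u D) * (card V + 2) + card W + 1"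

text \<open>The factor \<open>card V + 2\<close> exceeds \<open>card W + 1\<close>, so a cut, which
  takes \<open>u\<close> out of the count at once, pays for all her distribution steps and the final
  \<open>finish\<close>.\<close>

lemma step_remaining:
  assumes "step T r \<rho> s s'" "state_inv s"
  shows "remaining s' < remaining s"
  using assms
proof cases
  case (cut u D m H C Y c)
  have "card (V - D) = Suc (card (V - insert u D))"
    using card.remove[OF _ cut(3)] pair_finite_verts by (metis Diff_insert finite_Diff)
  moreover have "card (sub u - {u}) \<le> card V"
    by (rule card_mono[OF pair_finite_verts]) (use cut(3) sub_subset in blast)
  ultimately show ?thesis unfolding cut(1,2) by simp
next
  case (take v W K U Y D H c u)
  have "distributing_inv D (H(u := \<Union>k\<in>U. Y k)) c u Y U W" using assms(2) take(1) by simp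
  then have "W \<subseteq> sub u - {u}" "u \<in> V" unfolding distributing_inv_def by blast+
  then have "finite W" using finite_sub[of u] finite_subset by blast
  then have "card (W - {v}) < card W" using take(3) by (rule card_Diff1_less)
  then show ?thesis unfolding take(1,2) by simp
next
  case (finish D H c u Y U)
  then show ?thesis unfolding finish(1,2) by simp
qed

lemma no_infinite_run:
  "\<not> (\<sigma> 0 = initial_state r \<and> (\<forall>k. step T r \<rho> (\<sigma> k) (\<sigma> (Suc k))))"
proof
  assume \<sigma>: "\<sigma> 0 = initial_state r \<and> (\<forall>k. step T r \<rho> (\<sigma> k) (\<sigma> (Suc k)))"
  have inv: "state_inv (\<sigma> k)" for k
    by (induction k) (use \<sigma> initial_inv step_inv in auto)
  have "\<forall>k. (\<sigma> (Suc k), \<sigma> k) \<in> Wellfounded.measure remaining"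
    using \<sigma> inv step_remaining by simp
  then show False using wf_measure[of remaining] unfolding wf_iff_no_infinite_down_chain by blast
qed

text \<open>A run cannot block early: the slice counts are integers, an equal slicing always exists,
  and by the invariant on \<open>card U\<close> the untaken slices cover the shares of everybody in
  \<open>W\<close>.\<close>

lemma progress:
  assumes inv: "state_inv s" and stuck: "\<nexists>s'. step T r \<rho> s s'"
  shows "\<exists>H c. s = Ready V H c"
proof (cases s)
  case (Ready D H c)
  then have D: "D \<subseteq> V" and H: "allocation V H" using inv by (auto simp: ready_inv_def)
  have "V - D = {}"
  proof (rule ccontr)
    assume "V - D \<noteq> {}"
    then obtain u where u: "u \<in> V - D" "\<forall>w\<in>V - D. dep u \<le> dep w"
      using ex_has_least_nat[of "\<lambda>u. u \<in> V - D" _ dep] by blast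
    obtain m where m: "real m = slices u" using slices_nat u by blast
    then have "m > 0" using slices_pos[of u] u by (metis DiffD1 of_nat_0_less_iff)
    then obtain C Y where "slicing (H u) C m Y" "\<forall>k<m. \<forall>l<m. val u (Y k) = val u (Y l)"
      using equal_slicing[of "\<rho> u" "H u" m] integrable nonneg allocation_piece[OF H] u by blast
    then show False using stuck step.cut[OF u m] Ready by blast
  qed
  then show ?thesis using D Ready by blast
next
  case (Distributing D H c u Y U W)
  then have inv': "distributing_inv D (H(u := \<Union>k\<in>U. Y k)) c u Y U W" using inv by simp
  have "W \<noteq> {}"
  proof
    assume "W = {}"
    with step.finish[of T r \<rho> D H c u Y U] stuck show False unfolding Distributing by blast
  qed
  then obtain v where v: "v \<in> W" "\<forall>w\<in>W. dep v \<le> dep w"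
    using ex_has_least_nat[of "\<lambda>w. w \<in> W" _ dep] by blast
  have W: "W \<subseteq> sub u - {u}" and u: "u \<in> V" and U: "finite U"
    and card: "real (card U) = fact maxdep + (\<Sum>w\<in>W. share w)"
    using inv' by (auto simp: distributing_inv_def)
  have WV: "w \<in> V \<and> dep w > 0" if "w \<in> W" for w
  proof -
    have "w \<in> sub u" "w \<noteq> u" using that W by auto
    then show ?thesis using depth_pos[of w u] by (simp add: mem_sub_iff)
  qed
  then have finW: "finite W" using pair_finite_verts by (meson finite_subset subsetI)
  obtain p where p: "real p = share v" using share_nat WV v by blast
  have "share v \<le> (\<Sum>w\<in>W. share w)"
    using v finW WV share_pos by (intro member_le_sum) (auto simp: less_imp_le)
  then have "real p \<le> real (card U)" using card p fact_ge_zero[of maxdep, where 'a=real] by linarith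
  then obtain K where K: "K \<subseteq> U" "card K = p" "\<forall>k\<in>K. \<forall>l\<in>U - K. val v (Y l) \<le> val v (Y k)"
    using exists_top_subset[OF U, of p "\<lambda>k. val v (Y k)"] by auto
  have cardK: "real (card K) = slices v / real (dep v)" using p K(2) by (simp add: share_def)
  have "step T r \<rho> s (Distributing D (H(v := H v \<union> (\<Union>k\<in>K. Y k))) c u Y (U - K) (W - {v}))"
    unfolding Distributing by (rule step.take; fact v K cardK)
  then show ?thesis using stuck by blast
qed

section \<open>Number of cuts and proportionality\<close>

lemma sum_slices_le: "(\<Sum>v\<in>V. slices v) \<le> real (card V ^ 2 * fact maxdep)"
proof -
  have "slices v \<le> real (card V) * fact maxdep" if v: "v \<in> V" for v
  proof -
    \<comment> \<open>The denominator is at least 1, and the numerator counts the disjoint sets of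
      ancestors and of members of \<open>sub v\<close>.\<close>
    have "real (dep v + card (sub v)) / real (dep v + 1) \<le> real (dep v + card (sub v)) / 1"
      by (intro divide_left_mono) auto
    also have "\<dots> \<le> real (card V)" using depth_plus_card_sub[OF v] by simp
    finally show ?thesis unfolding num_slices_def by (intro mult_right_mono) auto
  qed
  then have "(\<Sum>v\<in>V. slices v) \<le> (\<Sum>v\<in>V. real (card V) * fact maxdep)" by (intro sum_mono)
  then show ?thesis by (simp add: power2_eq_square)
qed

text \<open>For proportionality, \<open>i\<close> is removed from \<open>burden\<close>: this takes
  \<open>val i (H i)\<close> off the left and 1 from the factor on the right.\<close>

lemma ready_all:
  assumes inv: "ready_inv V H c"
  shows "allocation V H" "c \<le> card V ^ 2 * fact maxdep"
    and "i \<in> V \<Longrightarrow> (\<Sum>j\<in>ancestors i \<union> (sub i - {i}). val i (H j))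
      \<le> real (card (ancestors i \<union> (sub i - {i}))) * val i (H i)"
proof -
  show "allocation V H" using inv by (simp add: ready_inv_def)
  have "real c \<le> real (card V ^ 2 * fact maxdep)"
    using inv sum_slices_le by (simp add: ready_inv_def)
  then show "c \<le> card V ^ 2 * fact maxdep" by (simp only: of_nat_le_iff)
  assume i: "i \<in> V"
  have disj: "ancestors i \<inter> (sub i - {i}) = {}" using ancestors_disjoint_sub[OF i] by blast
  have anc_i: "V \<inter> ancestors i = ancestors i"
    using i anc_in_verts by (auto simp: ancestors_def)
  have "burden H V i \<le> real (dep i + card (sub i)) * val i (H i)"
    using inv i unfolding ready_inv_def by blast
  then have b: "(\<Sum>j\<in>sub i. val i (H j)) + (\<Sum>j\<in>ancestors i. val i (H j))
      \<le> real (dep i + card (sub i)) * val i (H i)"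
    unfolding burden_def anc_i .
  have mem: "i \<in> sub i" by (simp add: mem_sub_iff)
  have sum: "(\<Sum>j\<in>ancestors i \<union> (sub i - {i}). val i (H j))
      = (\<Sum>j\<in>ancestors i. val i (H j)) + ((\<Sum>j\<in>sub i. val i (H j)) - val i (H i))"
    using disj finite_ancestors finite_sub[OF i] mem by (simp add: sum.union_disjoint sum_diff1)
  have card: "real (card (ancestors i \<union> (sub i - {i}))) = real (dep i + card (sub i)) - 1"
    using disj finite_ancestors finite_sub[OF i] mem card_sub_pos[OF i]
    by (simp add: card_Un_disjoint card_ancestors[OF i] of_nat_diff)
  show "(\<Sum>j\<in>ancestors i \<union> (sub i - {i}). val i (H j))
      \<le> real (card (ancestors i \<union> (sub i - {i}))) * val i (H i)"
    unfolding sum card left_diff_distrib using b by simp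
qed

lemma reachable_stuck:
  assumes "(step T r \<rho>)\<^sup>*\<^sup>* (initial_state r) s" "\<nexists>s'. step T r \<rho> s s'"
  obtains H c where "s = Ready V H c" "ready_inv V H c"
  using progress[OF reachable_inv[OF assms(1)] assms(2)] reachable_inv[OF assms(1)] by auto

end

text \<open>Excluding infinite runs and describing all stuck reachable states together ensures that
  every run, whatever its choices, ends in a complete allocation.\<close>

theorem theorem4:
  fixes G T :: "'a pair_pre_digraph" and r :: 'a and \<rho> :: "'a \<Rightarrow> real \<Rightarrow> real"
  assumes "descendant_graph G T r"
    and "\<And>i. i \<in> pverts G \<Longrightarrow> set_integrable lebesgue {0..1} (\<rho> i)"
    and "\<And>i x. i \<in> pverts G \<Longrightarrow> x \<in> {0..1} \<Longrightarrow> \<rho> i x \<ge> 0"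
  shows "(\<nexists>\<sigma>. \<sigma> 0 = initial_state r \<and> (\<forall>k. step T r \<rho> (\<sigma> k) (\<sigma> (Suc k)))) \<and>
    (\<forall>s. (step T r \<rho>)\<^sup>*\<^sup>* (initial_state r) s \<and> (\<nexists>s'. step T r \<rho> s s') \<longrightarrow>
      (\<exists>A c. s = Ready (pverts G) A c \<and>
        allocation (pverts G) A \<and> proportional_on G \<rho> A \<and>
        c \<le> card (pverts G) ^ 2 * fact (tree_depth T r)))"
proof -
  have verts: "pverts G = pverts T"
    using assms(1) by (simp add: descendant_graph_def spanning_def)
  interpret cake_sharing T r \<rho>
    using assms by unfold_locales (auto simp: descendant_graph_def verts)
  interpret G: pair_graph G
    using assms(1) by (simp add: descendant_graph_def)
  have neighbors: "neighbors G i = ancestors i \<union> (sub i - {i})" if i: "i \<in> V" for i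
  proof (rule set_eqI)
    fix j
    show "j \<in> neighbors G i \<longleftrightarrow> j \<in> ancestors i \<union> (sub i - {i})"
    proof (cases "j \<in> V")
      case True
      then have "(i, j) \<in> parcs G \<longleftrightarrow> anc i j \<or> anc j i"
        using assms(1) i by (simp add: descendant_graph_def verts)
      then show ?thesis
        using True anc_irrefl[of i] by (auto simp: neighbors_def ancestors_def mem_sub_iff)
    next
      case False
      then have "(i, j) \<notin> parcs G" using G.in_arcsD2[of i j] verts by blast
      moreover have "\<not> anc j i" using False anc_in_verts i by blast
      ultimately show ?thesis using False by (simp add: neighbors_def ancestors_def mem_sub_iff)
    qed
  qed
  have proportional: "proportional_on G \<rho> H" if inv: "ready_inv V H c" for H c
    unfolding proportional_on_def
  proof (intro ballI impI)
    fix i assume i: "i \<in> pverts G" and ne: "neighbors G i \<noteq> {}"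
    then have iV: "i \<in> V" by (simp add: verts)
    have "finite (neighbors G i)"
      using iV finite_ancestors finite_sub by (simp add: neighbors)
    then have "real (card (neighbors G i)) > 0" using ne by (simp add: card_gt_0_iff)
    then show "1 / real (card (neighbors G i)) * (\<Sum>j\<in>neighbors G i. val i (H j)) \<le> val i (H i)"
      using ready_all(3)[OF inv iV] by (simp add: neighbors[OF iV, symmetric] field_simps)
  qed
  have "\<exists>A c. s = Ready V A c \<and> allocation V A \<and> proportional_on G \<rho> A \<and> c \<le> card V ^ 2 * fact maxdep"
    if "(step T r \<rho>)\<^sup>*\<^sup>* (initial_state r) s" "\<nexists>s'. step T r \<rho> s s'" for s
    using reachable_stuck[OF that] ready_all(1,2) proportional by metis
  then show ?thesis unfolding verts using no_infinite_run by blast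
qed

end
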